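(* Let $\mathbb{K}$ be an algebraically closed field of characteristic $0$ and let $n\ge3$. Let $F\in\mathbb{K}[x_0,\dots,x_n]_4$ be any one of the following reducible quartics, where $\lambda\in\mathbb{K}$ is arbitrary: $$F_4=x_0x_1(x_2^2+\cdots+x_n^2),\quad F_5=x_0x_1(x_1x_2+x_3^2+\cdots+x_n^2),\quad F_6=x_0x_1(x_1^2+\cdots+x_n^2),$$ $$F_7=x_0(x_0+x_1)(x_1^2+\cdots+x_n^2),\quad F_{8,\lambda}=x_0(\lambda x_0+x_1)(x_0^2+\cdots+x_n^2),$$ $$F_9=x_0x_1(x_0^2+x_1x_2+x_3^2+\cdots+x_n^2),\quad F_{10,\lambda}=x_0(-\lambda^2x_0+x_1+\lambda x_2)(x_0x_1+x_2^2+\cdots+x_n^2).$$ Then $\mathrm{srk}(F)\ge4(n-1)$ and $\mathrm{psrk}(F)\ge3(n-1)$.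
   Context: For a form $F\in R=\mathbb{K}[x_0,\dots,x_n]$ of degree $d$, the symmetric (Waring) rank $\mathrm{srk}(F)$ is the minimal $r$ such that there are linear forms $m_1,\dots,m_r\in R_1$ with $F\in\langle m_1^d,\dots,m_r^d\rangle$. The partially symmetric rank $\mathrm{psrk}(F)$ is the minimal $r$ such that there are $m_1,\dots,m_r\in R_1$ with $\partial F/\partial x_i\in\langle m_1^{d-1},\dots,m_r^{d-1}\rangle$ for every $i\in\{0,\dots,n\}$. *)

theory Defs
  imports "HOL-Library.Poly_Mapping" "HOL-Computational_Algebra.Polynomial"
begin

text \<open>
  Polynomials in the variables x_0, x_1, x_2, ... are finitely supported functions from
  exponent vectors to coefficients; multiplication is the convolution product of
  \<^theory>\<open>HOL-Library.Poly_Mapping\<close>.  The ring K[x_0, ..., x_n] is the subring of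
  those polynomials in which only variables with index at most n occur.
\<close>

type_synonym 'a mpoly = "(nat \<Rightarrow>\<^sub>0 nat) \<Rightarrow>\<^sub>0 'a"

definition const :: "'a::comm_ring_1 \<Rightarrow> 'a mpoly" where
  "const c = Poly_Mapping.single 0 c"

definition var :: "nat \<Rightarrow> 'a::comm_ring_1 mpoly" where
  "var i = Poly_Mapping.single (Poly_Mapping.single i 1) 1"

definition scale :: "'a::comm_ring_1 \<Rightarrow> 'a mpoly \<Rightarrow> 'a mpoly" where
  "scale c p = const c * p"

global_interpretation mpoly: vector_space "scale :: 'a::field \<Rightarrow> 'a mpoly \<Rightarrow> 'a mpoly"
proof
  fix a b :: 'a and p q :: "'a mpoly"
  show "scale a (p + q) = scale a p + scale a q"
    by (simp add: scale_def algebra_simps)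
  show "scale (a + b) p = scale a p + scale b p"
    by (simp add: scale_def const_def single_add algebra_simps)
  show "scale a (scale b p) = scale (a * b) p"
    by (simp add: scale_def const_def mult_single flip: mult.assoc)
  show "scale 1 p = p"
    by (simp add: scale_def const_def)
qed

text \<open>The graded piece of degree d of K[x_0, ..., x_n].\<close>

definition forms :: "nat \<Rightarrow> nat \<Rightarrow> 'a::comm_ring_1 mpoly set" where
  "forms n d = {p. \<forall>m \<in> Poly_Mapping.keys p.
      Poly_Mapping.keys m \<subseteq> {..n} \<and> (\<Sum>i\<in>Poly_Mapping.keys m. Poly_Mapping.lookup m i) = d}"

text \<open>
  In the partial derivative below, the truncating subtraction of exponent vectors is harmless:
  if x_i does not occur in the monomial m, the coefficient is 0.
\<close>

definition pderiv_var :: "nat \<Rightarrow> 'a::comm_ring_1 mpoly \<Rightarrow> 'a mpoly" where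
  "pderiv_var i p = (\<Sum>m\<in>Poly_Mapping.keys p.
      Poly_Mapping.single (m - Poly_Mapping.single i 1)
        (of_nat (Poly_Mapping.lookup m i) * Poly_Mapping.lookup p m))"

text \<open>
  The ranks of a form F of degree d in K[x_0, ..., x_n].  The degree is a parameter, as the
  zero form has every degree.  The linear forms need not be distinct or nonzero.
\<close>

definition srk :: "nat \<Rightarrow> nat \<Rightarrow> 'a::field mpoly \<Rightarrow> nat" where
  "srk n d F = (LEAST r. \<exists>m :: nat \<Rightarrow> 'a mpoly. (\<forall>j<r. m j \<in> forms n 1) \<and>
      F \<in> mpoly.span ((\<lambda>j. m j ^ d) ` {..<r}))"

definition psrk :: "nat \<Rightarrow> nat \<Rightarrow> 'a::field mpoly \<Rightarrow> nat" where
  "psrk n d F = (LEAST r. \<exists>m :: nat \<Rightarrow> 'a mpoly. (\<forall>j<r. m j \<in> forms n 1) \<and>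
      (\<forall>i\<le>n. pderiv_var i F \<in> mpoly.span ((\<lambda>j. m j ^ (d - 1)) ` {..<r})))"

end

theory Submission
  imports Defs
begin

text \<open>
  Every quartic here is a product of two linear forms and a quadric.  Let T be its polarization and
  N = n - 1.  There are vectors f0, f1 and w_i, y_i (i = 2, ..., n) such that the matrix
  T(f0, f1, w_i, y_k) is diagonal and invertible, whereas T vanishes on most quadruples with three
  arguments among the w_i, y_i.

  A decomposition of the first partials into r cubes of linear forms m_j reads
  T(p, q, r, s) = sum_j a_j(p) m_j(q) m_j(r) m_j(s).  Translating f0 by a combination of the w_i
  makes N of the a_j vanish, translating f1 makes N of the remaining m_j vanish, and the pairing
  that is left is still nondegenerate on the span of the w_i, so at least N terms survive.

  For a decomposition of the form itself (a_j a multiple of m_j), let X be the set of those m_j that do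
  not vanish on all w_i, and choose a combination t of the w_i at which no element of X
  vanishes.  The cubics f0 f1 y_k, t f0 w_k, t f1 y_k, t^2 w_k are 4N linearly
  independent functions on X: pairing a relation with the w_i through T kills the first family, a factor t
  cancels, and the other families are killed in the same way.  Hence X has at least 4N elements.
\<close>

section \<open>Homogeneous linear systems\<close>

text \<open>Gaussian elimination by induction on the equations: an equation with no nonzero
  coefficient on \<open>I\<close> is dropped; any other eliminates one unknown \<open>p\<close>,
  whose value \<open>z\<close> is recovered by back-substitution.\<close>

lemma homogeneous_system:
  fixes M :: "'b \<Rightarrow> 'c \<Rightarrow> 'a::field"
  assumes "finite S" "finite I" "card S < card I"
  shows "\<exists>x. (\<exists>i\<in>I. x i \<noteq> 0) \<and> (\<forall>j\<in>S. (\<Sum>i\<in>I. M j i * x i) = 0)"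
  using assms
proof (induction S arbitrary: M I rule: finite_induct)
  case empty
  then obtain i where "i \<in> I" by fastforce
  then show ?case by (intro exI[of _ "\<lambda>_. 1"]) auto
next
  case (insert s S)
  show ?case
  proof (cases "\<exists>p\<in>I. M s p \<noteq> 0")
    case False
    have "card S < card I" using insert by simp
    then obtain x where x: "\<exists>i\<in>I. x i \<noteq> 0" "\<forall>j\<in>S. (\<Sum>i\<in>I. M j i * x i) = 0"
      using insert.IH[of I M] insert.prems by auto
    then show ?thesis using False by (intro exI[of _ x]) auto
  next
    case True
    then obtain p where p: "p \<in> I" "M s p \<noteq> 0" by blast
    define M' where "M' j i = M j i - M j p * M s i / M s p" for j i
    have "card S < card (I - {p})" using insert p by simp
    then obtain x where x: "\<exists>i\<in>I - {p}. x i \<noteq> 0"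
        "\<forall>j\<in>S. (\<Sum>i\<in>I - {p}. M' j i * x i) = 0"
      using insert.IH[of "I - {p}" M'] insert.prems by auto
    define z where "z = - (\<Sum>i\<in>I - {p}. M s i * x i) / M s p"
    have split: "(\<Sum>i\<in>I. M j i * (x(p := z)) i) = M j p * z + (\<Sum>i\<in>I - {p}. M j i * x i)" for j
      using p insert.prems by (simp add: sum.remove[of I p])
    have "(\<Sum>i\<in>I. M j i * (x(p := z)) i) = 0" if "j \<in> insert s S" for j
    proof (cases "j = s")
      case True
      then show ?thesis unfolding split using p by (simp add: z_def)
    next
      case False
      have "(\<Sum>i\<in>I - {p}. M' j i * x i) =
          (\<Sum>i\<in>I - {p}. M j i * x i) - (M j p / M s p) * (\<Sum>i\<in>I - {p}. M s i * x i)"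
        unfolding M'_def by (simp add: algebra_simps sum_subtractf sum_distrib_left)
      then show ?thesis unfolding split using x(2) False that by (simp add: z_def)
    qed
    then show ?thesis using x(1) by (intro exI[of _ "x(p := z)"]) auto
  qed
qed

text \<open>A translation with the most zeros works. Were there fewer than \<open>card I\<close>
  zeros, some nonzero direction would preserve all of them, and by \<open>inj\<close> moving along
  it changes another entry, which can then be brought to zero.\<close>

lemma exists_translate_few_nonzero:
  fixes M :: "'b \<Rightarrow> 'c \<Rightarrow> 'a::field"
  assumes fin: "finite S" "finite I"
    and inj: "\<And>x. \<forall>j\<in>S. (\<Sum>i\<in>I. M j i * x i) = 0 \<Longrightarrow> \<forall>i\<in>I. x i = 0"
  obtains x where "card {j \<in> S. e j + (\<Sum>i\<in>I. M j i * x i) \<noteq> 0} + card I \<le> card S"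
proof -
  define Z where "Z x = {j \<in> S. e j + (\<Sum>i\<in>I. M j i * x i) = 0}" for x
  have bound: "\<forall>x. card (Z x) < Suc (card S)"
    using fin by (simp add: Z_def card_mono less_Suc_eq_le)
  have "\<exists>x. \<forall>x'. card (Z x') \<le> card (Z x)"
    using ex_has_greatest_nat[of "\<lambda>_. True" undefined "\<lambda>x. card (Z x)" "Suc (card S)"] bound
    by (simp only: simp_thms)
  then obtain x where x: "\<And>x'. card (Z x') \<le> card (Z x)" by blast
  have "card I \<le> card (Z x)"
  proof (rule ccontr)
    assume "\<not> card I \<le> card (Z x)"
    then obtain d where d: "\<exists>i\<in>I. d i \<noteq> 0" "\<forall>j\<in>Z x. (\<Sum>i\<in>I. M j i * d i) = 0"
      using homogeneous_system[of "Z x" I M] fin by (auto simp: Z_def)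
    then obtain p where p: "p \<in> S" "(\<Sum>i\<in>I. M p i * d i) \<noteq> 0" using inj by blast
    define a where "a = - (e p + (\<Sum>i\<in>I. M p i * x i)) / (\<Sum>i\<in>I. M p i * d i)"
    have lin: "(\<Sum>i\<in>I. M j i * (x i + a * d i)) = (\<Sum>i\<in>I. M j i * x i) + a * (\<Sum>i\<in>I. M j i * d i)" for j
      by (simp add: algebra_simps sum.distrib sum_distrib_left)
    have "e p + ((\<Sum>i\<in>I. M p i * x i) + a * (\<Sum>i\<in>I. M p i * d i)) = 0"
      using p by (simp add: a_def)
    then have "insert p (Z x) \<subseteq> Z (\<lambda>i. x i + a * d i)"
      using p d(2) unfolding Z_def lin by auto
    moreover have "p \<notin> Z x" using p d by blast
    moreover have finZ: "finite (Z y)" for y using fin by (simp add: Z_def)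
    ultimately have "Suc (card (Z x)) \<le> card (Z (\<lambda>i. x i + a * d i))"
      using card_mono[OF finZ, of "insert p (Z x)"] by simp
    then show False using x[of "\<lambda>i. x i + a * d i"] by simp
  qed
  moreover have "card {j \<in> S. e j + (\<Sum>i\<in>I. M j i * x i) \<noteq> 0} + card (Z x) = card S"
    unfolding Z_def using fin by (subst card_Un_disjoint[symmetric]) (auto intro!: arg_cong[of _ _ card])
  ultimately show thesis using that[of x] by linarith
qed

text \<open>On a line \<open>x + a * d\<close>, a functional that vanishes at \<open>d\<close> keeps
  its nonzero value at \<open>x\<close>, and any other excludes a single value of \<open>a\<close>.
  A field of characteristic 0 is infinite, so some \<open>a\<close> is left.\<close>

lemma avoid_zeros:
  fixes M :: "'b \<Rightarrow> 'c \<Rightarrow> 'a::field_char_0"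
  assumes "finite S"
    and "\<And>j. j \<in> S \<Longrightarrow> \<exists>x. (\<Sum>i\<in>I. M j i * x i) \<noteq> 0"
  shows "\<exists>x. \<forall>j\<in>S. (\<Sum>i\<in>I. M j i * x i) \<noteq> 0"
  using assms
proof (induction S rule: finite_induct)
  case empty
  then show ?case by simp
next
  case (insert s S)
  obtain x where x: "\<forall>j\<in>S. (\<Sum>i\<in>I. M j i * x i) \<noteq> 0" using insert by blast
  obtain d where d: "(\<Sum>i\<in>I. M s i * d i) \<noteq> 0" using insert.prems by blast
  define e where "e y j = (\<Sum>i\<in>I. M j i * y i)" for y j
  \<comment> \<open>Where \<open>e d j = 0\<close> the quotient is 0, one more excluded value that
    does no harm.\<close>
  define bad where "bad = insert (- e x s / e d s) ((\<lambda>j. - e x j / e d j) ` S)"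
  have "finite bad" using insert.hyps by (simp add: bad_def)
  then obtain a where a: "a \<notin> bad" using ex_new_if_finite[OF infinite_UNIV_char_0] by blast
  have lin: "e (\<lambda>i. x i + a * d i) j = e x j + a * e d j" for j
    by (simp add: e_def algebra_simps sum.distrib sum_distrib_left)
  have "e x j + a * e d j \<noteq> 0" if "j \<in> insert s S" for j
  proof (cases "e d j = 0")
    case True
    then show ?thesis using that x d by (auto simp: e_def)
  next
    case False
    have "a \<noteq> - e x j / e d j" using a that by (auto simp: bad_def)
    then show ?thesis using False by (metis add.inverse_inverse add_eq_0_iff minus_divide_left nonzero_eq_divide_eq)
  qed
  then have "\<forall>j\<in>insert s S. e (\<lambda>i. x i + a * d i) j \<noteq> 0" by (simp only: lin) blast
  then show ?case unfolding e_def by (intro exI[of _ "\<lambda>i. x i + a * d i"])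
qed

text \<open>The vectors of the frame carry no linear structure: a combination with coefficients
  \<open>x\<close> is represented only by its values, the sums of \<open>N j k * x k\<close>. This
  lemma and the next carry vanishing and diagonal pairings over to such combinations.\<close>

lemma sum_lift_zero:
  fixes h :: "'b \<Rightarrow> 'a::comm_ring_1"
  assumes "\<And>k. k \<in> I \<Longrightarrow> (\<Sum>j\<in>S. h j * N j k) = 0"
  shows "(\<Sum>j\<in>S. h j * (\<Sum>k\<in>I. N j k * x k)) = 0"
proof -
  have "(\<Sum>j\<in>S. h j * (\<Sum>k\<in>I. N j k * x k)) = (\<Sum>k\<in>I. x k * (\<Sum>j\<in>S. h j * N j k))"
    unfolding sum_distrib_left by (subst sum.swap) (simp add: mult_ac)
  then show ?thesis using assms by simp
qed

lemma sum_lift_diag: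
  fixes h :: "'b \<Rightarrow> 'a::comm_ring_1"
  assumes fin: "finite I"
    and N: "\<And>k. k \<in> I \<Longrightarrow> (\<Sum>j\<in>S. h j * N j k) = (if k = i then c else 0)" and i: "i \<in> I"
  shows "(\<Sum>j\<in>S. h j * (\<Sum>k\<in>I. N j k * x k)) = c * x i"
proof -
  have "(\<Sum>j\<in>S. h j * (\<Sum>k\<in>I. N j k * x k)) = (\<Sum>k\<in>I. x k * (\<Sum>j\<in>S. h j * N j k))"
    unfolding sum_distrib_left by (subst sum.swap) (simp add: mult_ac)
  also have "\<dots> = (\<Sum>k\<in>I. if k = i then c * x k else 0)"
    by (intro sum.cong) (auto simp: N)
  finally show ?thesis using i fin by simp
qed

section \<open>Four-linear forms with few summands\<close>

text \<open>
  The scalars g_i are the diagonal entries of the pairing matrix.  Only its column y_k0 may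
  change when f1 is translated along the w_i; this happens when the quadric is degenerate on
  the span of the w_i.
\<close>

locale quartic_frame =
  fixes T :: "'v \<Rightarrow> 'v \<Rightarrow> 'v \<Rightarrow> 'v \<Rightarrow> 'a::field_char_0"
    and f0 f1 :: 'v and w y :: "'i \<Rightarrow> 'v" and I :: "'i set" and g :: "'i \<Rightarrow> 'a" and k0 :: 'i
  assumes fin: "finite I"
    and g_nonzero: "i \<in> I \<Longrightarrow> g i \<noteq> 0"
    and sym12: "T p q r s = T q p r s"
    and pairing: "i \<in> I \<Longrightarrow> k \<in> I \<Longrightarrow> T f0 f1 (w i) (y k) = (if i = k then g i else 0)"
    and wwf1y: "i \<in> I \<Longrightarrow> j \<in> I \<Longrightarrow> k \<in> I \<Longrightarrow> T (w i) (w j) f1 (y k) = 0"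
    and wwf0w: "i \<in> I \<Longrightarrow> j \<in> I \<Longrightarrow> k \<in> I \<Longrightarrow> T (w i) (w j) f0 (w k) = 0"
    and wwww: "i \<in> I \<Longrightarrow> j \<in> I \<Longrightarrow> k \<in> I \<Longrightarrow> l \<in> I \<Longrightarrow> T (w i) (w j) (w k) (w l) = 0"
    and wf0f0w: "i \<in> I \<Longrightarrow> k \<in> I \<Longrightarrow> T (w i) f0 f0 (w k) = 0"
    and f0wwy: "i \<in> I \<Longrightarrow> j \<in> I \<Longrightarrow> k \<in> I \<Longrightarrow> k \<noteq> k0 \<or> i = k0 \<Longrightarrow> T f0 (w j) (w i) (y k) = 0"
    and wwwy: "i \<in> I \<Longrightarrow> j \<in> I \<Longrightarrow> l \<in> I \<Longrightarrow> k \<in> I \<Longrightarrow> T (w i) (w j) (w l) (y k) = 0"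
begin

text \<open>If \<open>S\<close> were too small, counting would give a nontrivial relation among the
  four families. Multiplying by \<open>c j\<close> and testing successively against w_i, then w_i
  f0, then y_i f1, then y_i f1 f0, isolates the coefficients \<open>z 0\<close>, \<open>z 2\<close>,
  \<open>z 1\<close>, \<open>z 3\<close> through the pairing.\<close>

lemma card_powers_ge:
  assumes S: "finite S"
    and rep: "\<And>p q r s. T p q r s = (\<Sum>j\<in>S. c j * M j p * M j q * M j r * M j s)"
  shows "4 * card I \<le> card S"
proof (rule ccontr)
  assume few: "\<not> 4 * card I \<le> card S"
  \<comment> \<open>\<open>W x j\<close> and \<open>Y x j\<close> are the values of
    \<open>M j\<close> at the combinations of the w_k and of the y_k with coefficients
    \<open>x\<close>.\<close>
  define W Y where "W x j = (\<Sum>k\<in>I. M j (w k) * x k)" and "Y x j = (\<Sum>k\<in>I. M j (y k) * x k)" for x j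
  define S' where "S' = {j \<in> S. \<exists>i\<in>I. M j (w i) \<noteq> 0}"
  have S': "finite S'" "card S' \<le> card S" using S by (auto simp: S'_def intro: card_mono)
  have "\<exists>x. W x j \<noteq> 0" if j: "j \<in> S'" for j
  proof -
    obtain i where i: "i \<in> I" "M j (w i) \<noteq> 0" using j by (auto simp: S'_def)
    then have "W (\<lambda>k. if k = i then 1 else 0) j \<noteq> 0" using fin by (simp add: W_def if_distrib cong: if_cong)
    then show ?thesis by blast
  qed
  then obtain t where t: "\<And>j. j \<in> S' \<Longrightarrow> W t j \<noteq> 0"
    using avoid_zeros[OF S'(1), where M = "\<lambda>j k. M j (w k)" and I = I] unfolding W_def by blast
  have W_off: "W x j = 0" if "j \<in> S" "j \<notin> S'" for x j
    using that by (auto simp: W_def S'_def)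
  \<comment> \<open>The index \<open>s\<close> numbers the families f0 f1 y_k, t f0 w_k, t f1 y_k,
    t^2 w_k.\<close>
  define N where "N j = (\<lambda>(s::nat, k).
      if s = 0 then M j f0 * M j f1 * M j (y k)
      else if s = 1 then W t j * M j f0 * M j (w k)
      else if s = 2 then W t j * M j f1 * M j (y k)
      else W t j * W t j * M j (w k))" for j
  have "card S' < card ({..<4::nat} \<times> I)" using few S' by (simp add: card_cartesian_product)
  then obtain x where x: "\<exists>p\<in>{..<4} \<times> I. x p \<noteq> 0" "\<forall>j\<in>S'. (\<Sum>p\<in>{..<4} \<times> I. N j p * x p) = 0"
    using homogeneous_system[OF S'(1), of "{..<4::nat} \<times> I" N] fin by auto
  define z where "z s k = x (s, k)" for s k
  have sum_z: "(\<Sum>p\<in>{..<4} \<times> I. N j p * x p) =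
      M j f0 * M j f1 * Y (z 0) j + W t j * M j f0 * W (z 1) j
      + W t j * M j f1 * Y (z 2) j + W t j * W t j * W (z 3) j" for j
  proof -
    have "(\<Sum>p\<in>{..<4} \<times> I. N j p * x p) = (\<Sum>s<4. \<Sum>k\<in>I. N j (s, k) * z s k)"
      by (simp add: sum.cartesian_product z_def case_prod_unfold)
    also have "\<dots> = (\<Sum>k\<in>I. N j (0, k) * z 0 k) + (\<Sum>k\<in>I. N j (1, k) * z 1 k)
        + (\<Sum>k\<in>I. N j (2, k) * z 2 k) + (\<Sum>k\<in>I. N j (3, k) * z 3 k)"
      by (simp add: numeral_eq_Suc)
    finally show ?thesis by (simp add: N_def W_def Y_def sum_distrib_left mult.assoc)
  qed
  \<comment> \<open>This is the cofactor of t in the relation; once the family f0 f1 y_k is gone, t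
    cancels on \<open>S'\<close> and \<open>P\<close> vanishes there.\<close>
  define P where "P j = M j f0 * W (z 1) j + M j f1 * Y (z 2) j + W t j * W (z 3) j" for j
  have P: "M j f0 * M j f1 * Y (z 0) j + W t j * P j = 0" if "j \<in> S'" for j
    using x(2) that unfolding sum_z P_def by (simp add: algebra_simps)

  have lift_W: "(\<Sum>j\<in>S. h j * W v j) = 0" if "\<And>k. k \<in> I \<Longrightarrow> (\<Sum>j\<in>S. h j * M j (w k)) = 0" for h v
    unfolding W_def using that by (rule sum_lift_zero)
  have lift_Y: "(\<Sum>j\<in>S. h j * Y v j) = 0" if "\<And>k. k \<in> I \<Longrightarrow> (\<Sum>j\<in>S. h j * M j (y k)) = 0" for h v
    unfolding Y_def using that by (rule sum_lift_zero)
  have wwf1y': "(\<Sum>j\<in>S. c j * M j (w i) * W t j * M j f1 * M j (y k)) = 0" if "i \<in> I" "k \<in> I" for i k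
    using lift_W[of "\<lambda>j. c j * M j (w i) * M j f1 * M j (y k)" t] wwf1y[of i _ k] that
    by (simp add: rep mult_ac)
  have wwf0w': "(\<Sum>j\<in>S. c j * M j (w i) * W t j * M j f0 * M j (w k)) = 0" if "i \<in> I" "k \<in> I" for i k
    using lift_W[of "\<lambda>j. c j * M j (w i) * M j f0 * M j (w k)" t] wwf0w[of i _ k] that
    by (simp add: rep mult_ac)
  have wwww': "(\<Sum>j\<in>S. c j * M j (w i) * W t j * W t j * M j (w k)) = 0" if "i \<in> I" "k \<in> I" for i k
  proof -
    have "(\<Sum>j\<in>S. (c j * M j (w i) * M j (w k) * M j (w l)) * W t j) = 0" if "l \<in> I" for l
      using wwww[of i _ k l] \<open>i \<in> I\<close> \<open>k \<in> I\<close> that by (intro lift_W) (simp add: rep mult_ac)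
    then show ?thesis
      using lift_W[of "\<lambda>j. c j * M j (w i) * M j (w k) * W t j" t] by (simp add: mult_ac)
  qed

  have z0: "z 0 i = 0" if i: "i \<in> I" for i
  proof -
    \<comment> \<open>The relation is known only on \<open>S'\<close>, but elsewhere the factor
      \<open>M j (w i)\<close> is zero. Hence the sum may run over all of \<open>S\<close>, where it
      is expressed by values of \<open>T\<close>.\<close>
    have "(\<Sum>j\<in>S. c j * M j (w i) * (M j f0 * M j f1 * Y (z 0) j + W t j * P j)) = 0"
    proof (intro sum.neutral ballI)
      fix j assume "j \<in> S"
      then show "c j * M j (w i) * (M j f0 * M j f1 * Y (z 0) j + W t j * P j) = 0"
        using P[of j] i by (cases "j \<in> S'") (auto simp: S'_def)
    qed
    moreover have "(\<Sum>j\<in>S. (c j * M j (w i) * M j f0 * M j f1) * Y (z 0) j) = g i * z 0 i"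
      unfolding Y_def using pairing[of i] i by (intro sum_lift_diag fin) (auto simp: rep mult_ac)
    moreover have "(\<Sum>j\<in>S. (c j * M j (w i) * W t j * M j f0) * W (z 1) j) = 0"
      using wwf0w' i by (intro lift_W) auto
    moreover have "(\<Sum>j\<in>S. (c j * M j (w i) * W t j * M j f1) * Y (z 2) j) = 0"
      using wwf1y' i by (intro lift_Y) auto
    moreover have "(\<Sum>j\<in>S. (c j * M j (w i) * W t j * W t j) * W (z 3) j) = 0"
      using wwww' i by (intro lift_W) auto
    ultimately have "g i * z 0 i = 0"
      by (simp add: P_def algebra_simps sum.distrib)
    then show ?thesis using g_nonzero[OF i] by simp
  qed
  then have "Y (z 0) j = 0" for j by (simp add: Y_def)
  then have P0: "P j = 0" if "j \<in> S'" for j using P[OF that] t[OF that] by simp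
  have z2: "z 2 i = 0" if i: "i \<in> I" for i
  proof -
    have "(\<Sum>j\<in>S. c j * M j (w i) * M j f0 * P j) = 0"
    proof (intro sum.neutral ballI)
      fix j assume "j \<in> S"
      then show "c j * M j (w i) * M j f0 * P j = 0"
        using P0[of j] i by (cases "j \<in> S'") (auto simp: S'_def)
    qed
    moreover have "(\<Sum>j\<in>S. (c j * M j (w i) * M j f0 * M j f1) * Y (z 2) j) = g i * z 2 i"
      unfolding Y_def using pairing[of i] i by (intro sum_lift_diag fin) (auto simp: rep mult_ac)
    moreover have "(\<Sum>j\<in>S. (c j * M j (w i) * M j f0 * M j f0) * W (z 1) j) = 0"
      using wf0f0w i by (intro lift_W) (simp add: rep mult_ac)
    moreover have "(\<Sum>j\<in>S. (c j * M j (w i) * M j f0 * W t j) * W (z 3) j) = 0"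
      using wwf0w' i by (intro lift_W) (simp add: mult_ac)
    ultimately have "g i * z 2 i = 0"
      by (simp add: P_def algebra_simps sum.distrib)
    then show ?thesis using g_nonzero[OF i] by simp
  qed
  then have Y2: "Y (z 2) j = 0" for j by (simp add: Y_def)
  \<comment> \<open>With the y-terms gone, both remaining terms contain a combination of the w_k and
    so vanish outside \<open>S'\<close> too. From here on, test products without a factor w_i are
    allowed.\<close>
  have P_off: "M j f0 * W (z 1) j + W t j * W (z 3) j = 0" if "j \<in> S" for j
    using that P0[of j] W_off[of j] by (cases "j \<in> S'") (auto simp: P_def Y2)
  have z1: "z 1 i = 0" if i: "i \<in> I" for i
  proof -
    have "(\<Sum>j\<in>S. c j * M j (y i) * M j f1 * (M j f0 * W (z 1) j + W t j * W (z 3) j)) = 0"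
      using P_off by (intro sum.neutral) auto
    moreover have "(\<Sum>j\<in>S. (c j * M j (y i) * M j f1 * M j f0) * W (z 1) j) = g i * z 1 i"
      unfolding W_def using pairing[of _ i] i by (intro sum_lift_diag fin) (auto simp: rep mult_ac)
    moreover have "(\<Sum>j\<in>S. (c j * M j (y i) * M j f1 * W t j) * W (z 3) j) = 0"
      using wwf1y' i by (intro lift_W) (simp add: mult_ac)
    ultimately have "g i * z 1 i = 0"
      by (simp add: algebra_simps sum.distrib)
    then show ?thesis using g_nonzero[OF i] by simp
  qed
  then have "W (z 1) j = 0" for j by (simp add: W_def)
  \<comment> \<open>Here t is cancelled for the second time.\<close>
  then have W3: "W (z 3) j = 0" if "j \<in> S" for j
    using P_off[OF that] t[of j] W_off[OF that] by (cases "j \<in> S'") auto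
  have z3: "z 3 i = 0" if i: "i \<in> I" for i
  proof -
    have "(\<Sum>j\<in>S. (c j * M j (y i) * M j f1 * M j f0) * W (z 3) j) = g i * z 3 i"
      unfolding W_def using pairing[of _ i] i by (intro sum_lift_diag fin) (auto simp: rep mult_ac)
    then show ?thesis using W3 g_nonzero[OF i] by simp
  qed
  obtain s k where "s < 4" "k \<in> I" "z s k \<noteq> 0" using x(1) by (auto simp: z_def)
  moreover have "s = 0 \<or> s = 1 \<or> s = 2 \<or> s = 3" using \<open>s < 4\<close> by linarith
  ultimately show False using z0 z1 z2 z3 by auto
qed

text \<open>Both translations come from \<open>exists_translate_few_nonzero\<close>: by the pairing,
  no nontrivial combination of the w_i is a common zero of all \<open>A j\<close>, nor of all
  \<open>M j\<close> with \<open>j\<close> in \<open>S1\<close>. Each translation removes at least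
  \<open>card I\<close> indices, and at least as many survive in \<open>S2\<close>.\<close>

lemma card_partials_ge:
  assumes S: "finite S"
    and rep: "\<And>p q r s. T p q r s = (\<Sum>j\<in>S. A j p * M j q * M j r * M j s)"
  shows "3 * card I \<le> card S"
proof -
  have pair': "(\<Sum>j\<in>S. M j f0 * M j f1 * M j (y k) * A j (w i)) = (if i = k then g k else 0)"
    if "i \<in> I" "k \<in> I" for i k
  proof -
    have "(\<Sum>j\<in>S. M j f0 * M j f1 * M j (y k) * A j (w i)) = T (w i) f0 f1 (y k)"
      by (simp add: rep mult_ac)
    \<comment> \<open>The representation is visibly symmetric only in the last three arguments;
      \<open>sym12\<close> moves w_i out of the first one.\<close>
    also have "\<dots> = T f0 f1 (w i) (y k)" by (subst sym12) (simp add: rep mult_ac)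
    finally show ?thesis using pairing that by simp
  qed
  have "\<forall>i\<in>I. x i = 0" if "\<forall>j\<in>S. (\<Sum>i\<in>I. A j (w i) * x i) = 0" for x
  proof
    fix i assume i: "i \<in> I"
    have "(\<Sum>j\<in>S. (M j f0 * M j f1 * M j (y i)) * (\<Sum>k\<in>I. A j (w k) * x k)) = g i * x i"
      using i pair' by (intro sum_lift_diag fin) auto
    then show "x i = 0" using that g_nonzero[OF i] by simp
  qed
  then obtain x1 where x1: "card {j \<in> S. A j f0 + (\<Sum>i\<in>I. A j (w i) * x1 i) \<noteq> 0} + card I \<le> card S"
    using exists_translate_few_nonzero[OF S fin, of "\<lambda>j i. A j (w i)" "\<lambda>j. A j f0"] by metis
  \<comment> \<open>\<open>v\<close> holds the values of the \<open>A j\<close> at the translate of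
    f0. By \<open>expand_v\<close> the translation goes unnoticed by every \<open>h\<close> that
    pairs to zero with all w_l.\<close>
  define v where "v j = A j f0 + (\<Sum>i\<in>I. A j (w i) * x1 i)" for j
  have expand_v: "(\<Sum>j\<in>S. v j * h j) = (\<Sum>j\<in>S. A j f0 * h j)"
    if "\<And>l. l \<in> I \<Longrightarrow> (\<Sum>j\<in>S. A j (w l) * h j) = 0" for h
    using sum_lift_zero[where S = S and h = h and N = "\<lambda>j l. A j (w l)" and x = x1] that
    by (simp add: v_def algebra_simps sum.distrib)
  define S1 where "S1 = {j \<in> S. v j \<noteq> 0}"
  have S1: "finite S1" "S1 \<subseteq> S" using S by (auto simp: S1_def)
  have pair1: "(\<Sum>j\<in>S. v j * (M j f1 * M j (y k) * M j (w i))) = (if i = k then g k else 0)"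
    if "i \<in> I" "k \<in> I" for i k
  proof -
    have "(\<Sum>j\<in>S. A j (w l) * (M j f1 * M j (y k) * M j (w i))) = 0" if "l \<in> I" for l
      using wwf1y[of l i k] that \<open>i \<in> I\<close> \<open>k \<in> I\<close> by (simp add: rep mult_ac)
    then have "(\<Sum>j\<in>S. v j * (M j f1 * M j (y k) * M j (w i))) =
        (\<Sum>j\<in>S. A j f0 * (M j f1 * M j (y k) * M j (w i)))" by (rule expand_v)
    then show ?thesis using pairing[of i k] that by (simp add: rep mult_ac)
  qed
  have "\<forall>i\<in>I. x i = 0" if "\<forall>j\<in>S1. (\<Sum>i\<in>I. M j (w i) * x i) = 0" for x
  proof
    fix i assume i: "i \<in> I"
    have "(\<Sum>j\<in>S. (v j * (M j f1 * M j (y i))) * (\<Sum>k\<in>I. M j (w k) * x k)) = g i * x i"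
      using i pair1 by (intro sum_lift_diag fin) (auto simp: mult_ac)
    moreover have "(v j * (M j f1 * M j (y i))) * (\<Sum>k\<in>I. M j (w k) * x k) = 0" if "j \<in> S" for j
      using that \<open>\<forall>j\<in>S1. _\<close> by (auto simp: S1_def)
    ultimately show "x i = 0" using g_nonzero[OF i] by simp
  qed
  then obtain x2 where x2: "card {j \<in> S1. M j f1 + (\<Sum>i\<in>I. M j (w i) * x2 i) \<noteq> 0} + card I \<le> card S1"
    using exists_translate_few_nonzero[OF S1(1) fin, of "\<lambda>j i. M j (w i)" "\<lambda>j. M j f1"] by metis
  define u where "u j = M j f1 + (\<Sum>i\<in>I. M j (w i) * x2 i)" for j
  define S2 where "S2 = {j \<in> S1. u j \<noteq> 0}"
  have "card I \<le> card S2"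
  proof (rule ccontr)
    assume "\<not> card I \<le> card S2"
    then obtain z where z: "\<exists>i\<in>I. z i \<noteq> 0" "\<forall>j\<in>S2. (\<Sum>i\<in>I. M j (w i) * z i) = 0"
      using homogeneous_system[of S2 I "\<lambda>j i. M j (w i)"] fin S1(1) by (auto simp: S2_def)
    define Lz where "Lz j = (\<Sum>i\<in>I. M j (w i) * z i)" for j
    \<comment> \<open>The translates of f0 and f1 are paired with y_k and the combination
      \<open>z\<close>. Every summand is zero, because one of \<open>v j\<close>,
      \<open>u j\<close>, \<open>Lz j\<close> is. In the expansion the translation of f0 drops out
      and that of f1 leaves the sum as an error term.\<close>
    have rel: "g k * z k + (\<Sum>j\<in>S. A j f0 * M j (y k) * (\<Sum>l\<in>I. M j (w l) * x2 l) * Lz j) = 0"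
      if k: "k \<in> I" for k
    proof -
      have "(\<Sum>j\<in>S. v j * (u j * M j (y k) * Lz j)) = 0"
        using z(2) by (intro sum.neutral) (auto simp: S1_def S2_def Lz_def)
      moreover have "(\<Sum>j\<in>S. v j * (u j * M j (y k) * Lz j)) = (\<Sum>j\<in>S. A j f0 * (u j * M j (y k) * Lz j))"
      proof (rule expand_v)
        fix l assume l: "l \<in> I"
        have 1: "(\<Sum>j\<in>S. (A j (w l) * M j f1 * M j (y k)) * Lz j) = 0"
          unfolding Lz_def using wwf1y[of l _ k] l k
          by (intro sum_lift_zero) (simp add: rep mult_ac)
        have 2: "(\<Sum>j\<in>S. (A j (w l) * M j (y k) * (\<Sum>l\<in>I. M j (w l) * x2 l)) * Lz j) = 0"
          unfolding Lz_def
        proof (intro sum_lift_zero)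
          fix i assume i: "i \<in> I"
          have "(\<Sum>j\<in>S. (A j (w l) * M j (y k) * M j (w i)) * (\<Sum>l\<in>I. M j (w l) * x2 l)) = 0"
            using wwwy[of l i _ k] l k i by (intro sum_lift_zero) (simp add: rep mult_ac)
          then show "(\<Sum>j\<in>S. (A j (w l) * M j (y k) * (\<Sum>l\<in>I. M j (w l) * x2 l)) * M j (w i)) = 0"
            by (simp add: mult_ac)
        qed
        show "(\<Sum>j\<in>S. A j (w l) * (u j * M j (y k) * Lz j)) = 0"
          using 1 2 by (simp add: u_def algebra_simps sum.distrib)
      qed
      moreover have "(\<Sum>j\<in>S. (A j f0 * M j f1 * M j (y k)) * Lz j) = g k * z k"
        unfolding Lz_def using pairing[of _ k] k by (intro sum_lift_diag fin) (auto simp: rep mult_ac)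
      ultimately show ?thesis by (simp add: u_def algebra_simps sum.distrib)
    qed
    \<comment> \<open>The error matrix is concentrated in column \<open>k0\<close>, off the
      diagonal, so the system is triangular: the equations for \<open>k\<close> other than
      \<open>k0\<close> give \<open>z k = 0\<close>, after which the equation for \<open>k0\<close>
      sees only its diagonal entry and gives \<open>z k0 = 0\<close>.\<close>
    have entry: "(\<Sum>j\<in>S. (A j f0 * M j (y k) * (\<Sum>l\<in>I. M j (w l) * x2 l)) * M j (w i)) = 0"
      if "k \<in> I" "i \<in> I" "k \<noteq> k0 \<or> i = k0" for i k
    proof -
      have "(\<Sum>j\<in>S. (A j f0 * M j (y k) * M j (w i)) * (\<Sum>l\<in>I. M j (w l) * x2 l)) = 0"
        using f0wwy[of i _ k] that by (intro sum_lift_zero) (simp add: rep mult_ac)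
      then show ?thesis by (simp add: mult_ac)
    qed
    have off: "z k = 0" if "k \<in> I" "k \<noteq> k0" for k
    proof -
      have "(\<Sum>j\<in>S. (A j f0 * M j (y k) * (\<Sum>l\<in>I. M j (w l) * x2 l)) * Lz j) = 0"
        unfolding Lz_def using that entry by (intro sum_lift_zero) auto
      then show ?thesis using rel[OF that(1)] g_nonzero[OF that(1)] by simp
    qed
    have k0: "k0 \<in> I" "z k0 \<noteq> 0" using z(1) off by metis+
    then have "Lz j = M j (w k0) * z k0" for j
      unfolding Lz_def using fin off by (simp add: sum.remove[of I k0])
    then have "(\<Sum>j\<in>S. (A j f0 * M j (y k0) * (\<Sum>l\<in>I. M j (w l) * x2 l)) * Lz j) =
        (\<Sum>j\<in>S. (A j f0 * M j (y k0) * (\<Sum>l\<in>I. M j (w l) * x2 l)) * M j (w k0)) * z k0"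
      by (simp add: sum_distrib_left mult_ac)
    also have "\<dots> = 0" using entry[of k0 k0] k0 by simp
    finally show False using rel[OF k0(1)] g_nonzero k0 by simp
  qed
  then show ?thesis using x1 x2 unfolding S2_def S1_def v_def u_def by linarith
qed

end

section \<open>Derivatives of polynomials\<close>

text \<open>A common finite index set for several polynomials makes additivity a termwise
  statement.\<close>

lemma pderiv_var_eq_sum:
  assumes "finite A" "Poly_Mapping.keys p \<subseteq> A"
  shows "pderiv_var i p = (\<Sum>m\<in>A. Poly_Mapping.single (m - Poly_Mapping.single i 1)
        (of_nat (Poly_Mapping.lookup m i) * Poly_Mapping.lookup p m))"
  unfolding pderiv_var_def using assms
  by (intro sum.mono_neutral_left) (auto simp: in_keys_iff)

lemma pderiv_var_single:
  "pderiv_var i (Poly_Mapping.single m c) =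
    Poly_Mapping.single (m - Poly_Mapping.single i 1) (of_nat (Poly_Mapping.lookup m i) * c)"
  by (subst pderiv_var_eq_sum[of "{m}"]) auto

lemma pderiv_var_add: "pderiv_var i (p + q) = pderiv_var i p + pderiv_var i q"
proof -
  let ?A = "Poly_Mapping.keys p \<union> Poly_Mapping.keys q"
  have "Poly_Mapping.keys (p + q) \<subseteq> ?A" by (rule Poly_Mapping.keys_add)
  then show ?thesis
    by (simp add: pderiv_var_eq_sum[of ?A] lookup_add algebra_simps single_add sum.distrib)
qed

lemma pderiv_var_0 [simp]: "pderiv_var i 0 = 0"
  by (simp add: pderiv_var_def)

lemma mpoly_induct [case_names zero add]:
  assumes "P 0" and "\<And>m c p. P p \<Longrightarrow> P (Poly_Mapping.single m c + p)"
  shows "P (p :: 'a::comm_ring_1 mpoly)"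
proof (induction p rule: update_induct)
  case const
  then show ?case by (rule assms)
next
  case (update f a b)
  \<comment> \<open>The key \<open>a\<close> is fresh, so setting its coefficient amounts to adding
    a monomial.\<close>
  have "Poly_Mapping.update a b f = Poly_Mapping.single a b + f"
    using update.hyps
    by (intro poly_mapping_eqI) (auto simp: lookup_update lookup_add lookup_single in_keys_iff when_def)
  then show ?case using assms update by simp
qed

lemma pderiv_var_mult_single:
  "pderiv_var i (Poly_Mapping.single m c * Poly_Mapping.single k d) =
    pderiv_var i (Poly_Mapping.single m c) * Poly_Mapping.single k d
    + Poly_Mapping.single m c * pderiv_var i (Poly_Mapping.single k d)"
proof -
  let ?e = "Poly_Mapping.single i (1::nat)"
  \<comment> \<open>Truncated subtraction commutes with adding \<open>k\<close> only if x_i occurs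
    in \<open>m\<close>; otherwise the coefficient is 0 on both sides.\<close>
  have shift: "(m + k) - ?e = (m - ?e) + k" if "Poly_Mapping.lookup m i \<noteq> 0" for m k :: "nat \<Rightarrow>\<^sub>0 nat"
    using that by (intro poly_mapping_eqI)
      (auto simp: lookup_add lookup_minus lookup_single when_def)
  have "Poly_Mapping.single (m + k - ?e) (of_nat (Poly_Mapping.lookup m i) * (c * d))
      = Poly_Mapping.single (m - ?e + k) (of_nat (Poly_Mapping.lookup m i) * (c * d))"
    by (cases "Poly_Mapping.lookup m i = 0") (simp_all add: shift del: One_nat_def)
  moreover have "Poly_Mapping.single (m + k - ?e) (of_nat (Poly_Mapping.lookup k i) * (c * d))
      = Poly_Mapping.single (m + (k - ?e)) (of_nat (Poly_Mapping.lookup k i) * (c * d))"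
    using shift[of k m] by (cases "Poly_Mapping.lookup k i = 0") (simp_all add: add.commute del: One_nat_def)
  ultimately show ?thesis
    by (simp add: mult_single pderiv_var_single lookup_add algebra_simps single_add)
qed

lemma pderiv_var_mult:
  fixes p q :: "'a::comm_ring_1 mpoly"
  shows "pderiv_var i (p * q) = pderiv_var i p * q + p * pderiv_var i q"
proof (induction p rule: mpoly_induct)
  case zero
  then show ?case by simp
next
  case (add m c p)
  have "pderiv_var i (Poly_Mapping.single m c * q)
      = pderiv_var i (Poly_Mapping.single m c) * q + Poly_Mapping.single m c * pderiv_var i q"
    by (induction q rule: mpoly_induct)
      (simp_all add: distrib_left distrib_right pderiv_var_add pderiv_var_mult_single)
  then show ?case using add by (simp add: algebra_simps pderiv_var_add)
qed

lemma const_0 [simp]: "const 0 = 0" and const_1 [simp]: "const 1 = 1"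
  and const_add: "const (a + b) = const a + const b"
  and const_mult: "const (a * b) = const a * const b"
  and const_minus: "const (- a) = - const a"
  by (simp_all add: const_def single_add mult_single single_uminus)

lemma const_sum: "const (sum f A) = (\<Sum>x\<in>A. const (f x))"
  by (induction A rule: infinite_finite_induct) (simp_all add: const_add)

lemma const_eq_iff [simp]: "const a = const b \<longleftrightarrow> a = b"
  unfolding const_def by (metis lookup_single_eq)

lemma const_numeral: "const (numeral k) = numeral k"
  unfolding const_def by simp

lemma pderiv_var_const [simp]: "pderiv_var i (const c) = 0"
  by (simp add: const_def pderiv_var_single)

lemma pderiv_var_var: "pderiv_var i (var j) = (if i = j then 1 else 0)"
  by (auto simp: var_def pderiv_var_single lookup_single)

text \<open>In degree 1 a monomial that contains x_i is x_i itself, so lowering the exponent leaves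
  the exponent vector 0.\<close>

lemma pderiv_var_form_1:
  assumes "m \<in> forms n 1"
  shows "\<exists>c. pderiv_var i m = const c"
proof -
  have "Poly_Mapping.single (k - Poly_Mapping.single i 1) (of_nat (Poly_Mapping.lookup k i) * Poly_Mapping.lookup m k)
      = const (of_nat (Poly_Mapping.lookup k i) * Poly_Mapping.lookup m k)"
    if k: "k \<in> Poly_Mapping.keys m" for k
  proof (cases "Poly_Mapping.lookup k i = 0")
    case False
    have sum1: "(\<Sum>i\<in>Poly_Mapping.keys k. Poly_Mapping.lookup k i) = 1"
      using assms k by (auto simp: forms_def)
    have ik: "i \<in> Poly_Mapping.keys k" using False by (simp add: in_keys_iff)
    have rest: "Poly_Mapping.lookup k i + (\<Sum>j\<in>Poly_Mapping.keys k - {i}. Poly_Mapping.lookup k j) = 1"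
      using sum1 ik by (simp add: sum.remove[of _ i])
    then have "Poly_Mapping.lookup k j = 0" if "j \<noteq> i" for j
      using False that member_le_sum[of j "Poly_Mapping.keys k - {i}" "Poly_Mapping.lookup k"]
      by (cases "j \<in> Poly_Mapping.keys k") (auto simp: in_keys_iff)
    moreover have "Poly_Mapping.lookup k i \<le> 1" using rest by linarith
    ultimately have "k - Poly_Mapping.single i 1 = 0"
      by (intro poly_mapping_eqI) (auto simp: lookup_minus lookup_single when_def)
    then show ?thesis by (simp add: const_def)
  qed (simp add: const_def)
  then show ?thesis unfolding pderiv_var_def by (auto simp: const_sum[symmetric])
qed

section \<open>Directional derivatives and the polarization of a quartic\<close>

definition dir_deriv :: "nat \<Rightarrow> (nat \<Rightarrow> 'a) \<Rightarrow> 'a::comm_ring_1 mpoly \<Rightarrow> 'a mpoly" where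
  "dir_deriv n v p = (\<Sum>i\<le>n. const (v i) * pderiv_var i p)"

lemma dir_deriv_0 [simp]: "dir_deriv n v 0 = 0"
  by (simp add: dir_deriv_def)

lemma dir_deriv_add: "dir_deriv n v (p + q) = dir_deriv n v p + dir_deriv n v q"
  by (simp add: dir_deriv_def pderiv_var_add distrib_left sum.distrib)

lemma dir_deriv_sum: "dir_deriv n v (\<Sum>x\<in>A. h x) = (\<Sum>x\<in>A. dir_deriv n v (h x))"
  by (induction A rule: infinite_finite_induct) (simp_all add: dir_deriv_add)

lemma dir_deriv_mult: "dir_deriv n v (p * q) = dir_deriv n v p * q + p * dir_deriv n v q"
proof -
  have "dir_deriv n v (p * q) =
      (\<Sum>i\<le>n. const (v i) * pderiv_var i p * q + p * (const (v i) * pderiv_var i q))"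
    by (simp add: dir_deriv_def pderiv_var_mult algebra_simps)
  then show ?thesis by (simp add: dir_deriv_def sum.distrib sum_distrib_left sum_distrib_right)
qed

lemma dir_deriv_const [simp]: "dir_deriv n v (const c) = 0"
  by (simp add: dir_deriv_def)

lemma dir_deriv_numeral [simp]: "dir_deriv n v (numeral k) = 0"
  using dir_deriv_const[of n v "numeral k"] by (simp only: const_numeral)

lemma dir_deriv_var: "i \<le> n \<Longrightarrow> dir_deriv n v (var i) = const (v i)"
  by (simp add: dir_deriv_def pderiv_var_var if_distrib cong: if_cong)

lemma dir_deriv_form_1:
  assumes "m \<in> forms n 1"
  shows "\<exists>\<phi>. \<forall>v. dir_deriv n v m = const (\<phi> v)"
proof -
  obtain c where "\<And>i. pderiv_var i m = const (c i)"
    using pderiv_var_form_1[OF assms] by metis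
  then have "\<forall>v. dir_deriv n v m = const (\<Sum>i\<le>n. v i * c i)"
    by (simp add: dir_deriv_def const_sum const_mult)
  then show ?thesis by (rule exI[of _ "\<lambda>v. \<Sum>i\<le>n. v i * c i"])
qed

text \<open>The factor 6 is 3!, since the derivations can meet the factors in any order; fourth
  powers give 24 = 4!.\<close>

lemma dir_deriv_cube:
  assumes "\<And>v. dir_deriv n v m = const (\<phi> v)"
  shows "dir_deriv n s (dir_deriv n r (dir_deriv n q (m ^ 3))) = const (6 * \<phi> q * \<phi> r * \<phi> s)"
proof -
  have "dir_deriv n s (dir_deriv n r (dir_deriv n q (m ^ 3))) = 6 * const (\<phi> q) * const (\<phi> r) * const (\<phi> s)"
    by (simp add: power3_eq_cube dir_deriv_mult dir_deriv_add assms algebra_simps)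
  then show ?thesis by (simp add: const_mult const_numeral)
qed

lemma dir_deriv_fourth_power:
  assumes "\<And>v. dir_deriv n v m = const (\<phi> v)"
  shows "dir_deriv n s (dir_deriv n r (dir_deriv n q (dir_deriv n p (m ^ 4)))) =
    const (24 * \<phi> p * \<phi> q * \<phi> r * \<phi> s)"
proof -
  have "dir_deriv n s (dir_deriv n r (dir_deriv n q (dir_deriv n p (m ^ 4)))) =
      24 * const (\<phi> p) * const (\<phi> q) * const (\<phi> r) * const (\<phi> s)"
    by (simp add: power4_eq_xxxx dir_deriv_mult dir_deriv_add assms algebra_simps)
  then show ?thesis by (simp add: const_mult const_numeral)
qed

text \<open>The family may have repetitions, so coefficients are attached to indices rather than to
  elements of the image; each generator met in the induction is credited to one chosen
  index.\<close>

lemma span_family_eq_sum: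
  assumes "F \<in> mpoly.span (h ` {..<r::nat})"
  shows "\<exists>c. F = (\<Sum>j<r. scale (c j) (h j))"
  using assms
proof (induction rule: mpoly.span_induct_alt)
  case base
  show ?case by (intro exI[of _ "\<lambda>_. 0"]) simp
next
  case (step a p q)
  then obtain k c where k: "k < r" "p = h k" and c: "q = (\<Sum>j<r. scale (c j) (h j))" by blast
  have "scale a p + q = (\<Sum>j<r. scale ((if j = k then a else 0) + c j) (h j))"
    using k by (simp add: c mpoly.scale_left_distrib sum.distrib if_distribR if_distrib[of "\<lambda>x. scale x _"] cong: if_cong)
  then show ?case by (intro exI[of _ "\<lambda>j. (if j = k then a else 0) + c j"])
qed

lemma dir_deriv_scale: "dir_deriv n v (scale c p) = scale c (dir_deriv n v p)"
  by (simp add: scale_def dir_deriv_mult)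

lemma scale_const: "scale c (const d) = const (c * d)"
  by (simp add: scale_def const_mult)

text \<open>Four derivatives turn each fourth power into a product of four values of one functional
  \<open>M j\<close>; the factor 24 is absorbed into \<open>c\<close>.\<close>

lemma four_linear_form_of_powers:
  fixes r :: nat
  assumes m: "\<forall>j<r. m j \<in> forms n 1" and F: "F \<in> mpoly.span ((\<lambda>j. m j ^ 4) ` {..<r})"
    and T: "\<And>p q r s. dir_deriv n s (dir_deriv n r (dir_deriv n q (dir_deriv n p F))) = const (T p q r s)"
  shows "\<exists>c M. \<forall>p q r' s. T p q r' s = (\<Sum>j<r. c j * M j p * M j q * M j r' * M j s)"
proof -
  obtain c where c: "F = (\<Sum>j<r. scale (c j) (m j ^ 4))" using span_family_eq_sum[OF F] by blast
  have "\<forall>j\<in>{..<r}. \<exists>\<phi>. \<forall>v. dir_deriv n v (m j) = const (\<phi> v)"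
    using m dir_deriv_form_1 by blast
  then obtain M where M: "\<forall>j\<in>{..<r}. \<forall>v. dir_deriv n v (m j) = const (M j v)"
    by (rule bchoice[THEN exE])
  have "const (T p q r' s) = const (\<Sum>j<r. (24 * c j) * M j p * M j q * M j r' * M j s)" for p q r' s
    unfolding T[symmetric] c dir_deriv_sum dir_deriv_scale const_sum
  proof (intro sum.cong refl)
    fix j assume "j \<in> {..<r}"
    then show "scale (c j) (dir_deriv n s (dir_deriv n r' (dir_deriv n q (dir_deriv n p (m j ^ 4))))) =
        const (24 * c j * M j p * M j q * M j r' * M j s)"
      using M by (subst dir_deriv_fourth_power[of n "m j" "M j"]) (auto simp: scale_const mult_ac)
  qed
  then show ?thesis unfolding const_eq_iff by (intro exI[of _ "\<lambda>j. 24 * c j"] exI[of _ M]) blast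
qed

text \<open>The derivative along \<open>p\<close> is a combination of the partials, hence of the
  cubes, with coefficients linear in \<open>p\<close>; these form \<open>A\<close>. The other three
  derivatives act on the cubes and contribute 3! = 6.\<close>

lemma four_linear_form_of_partials:
  fixes r :: nat
  assumes m: "\<forall>j<r. m j \<in> forms n 1"
    and F: "\<forall>i\<le>n. pderiv_var i F \<in> mpoly.span ((\<lambda>j. m j ^ 3) ` {..<r})"
    and T: "\<And>p q r s. dir_deriv n s (dir_deriv n r (dir_deriv n q (dir_deriv n p F))) = const (T p q r s)"
  shows "\<exists>A M. \<forall>p q r' s. T p q r' s = (\<Sum>j<r. A j p * M j q * M j r' * M j s)"
proof -
  have "\<forall>i\<in>{..n}. \<exists>c. pderiv_var i F = (\<Sum>j<r. scale (c j) (m j ^ 3))"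
    using span_family_eq_sum[where h = "\<lambda>j. m j ^ 3"] F by simp
  then obtain a where a: "\<forall>i\<in>{..n}. pderiv_var i F = (\<Sum>j<r. scale (a i j) (m j ^ 3))"
    by (rule bchoice[THEN exE])
  have "\<forall>j\<in>{..<r}. \<exists>\<phi>. \<forall>v. dir_deriv n v (m j) = const (\<phi> v)"
    using m dir_deriv_form_1 by blast
  then obtain M where M: "\<forall>j\<in>{..<r}. \<forall>v. dir_deriv n v (m j) = const (M j v)"
    by (rule bchoice[THEN exE])
  define A where "A j p = (\<Sum>i\<le>n. 6 * p i * a i j)" for j p
  have DF: "dir_deriv n p F = (\<Sum>i\<le>n. \<Sum>j<r. scale (p i * a i j) (m j ^ 3))" for p
    by (simp add: dir_deriv_def a scale_def sum_distrib_left const_mult mult_ac)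
  have "const (T p q r' s) = const (\<Sum>j<r. A j p * M j q * M j r' * M j s)" for p q r' s
  proof -
    have "const (T p q r' s) = (\<Sum>i\<le>n. \<Sum>j<r. const (6 * p i * a i j * M j q * M j r' * M j s))"
      unfolding T[symmetric] DF dir_deriv_sum dir_deriv_scale
    proof (intro sum.cong refl)
      fix i j assume "j \<in> {..<r}"
      then show "scale (p i * a i j) (dir_deriv n s (dir_deriv n r' (dir_deriv n q (m j ^ 3)))) =
          const (6 * p i * a i j * M j q * M j r' * M j s)"
        using M by (subst dir_deriv_cube[of n "m j" "M j"]) (auto simp: scale_const mult_ac)
    qed
    also have "\<dots> = const (\<Sum>j<r. A j p * M j q * M j r' * M j s)"
      unfolding A_def const_sum sum_distrib_right by (rule sum.swap)
    finally show ?thesis .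
  qed
  then show ?thesis unfolding const_eq_iff by (intro exI[of _ A] exI[of _ M]) blast
qed

lemma pderiv_var_scale: "pderiv_var i (scale c p) = scale c (pderiv_var i p)"
  by (simp add: scale_def pderiv_var_mult)

section \<open>Spans of powers of linear forms\<close>

text \<open>Enumerating the finitely many generators in use gives one decomposition, which makes the
  \<open>LEAST\<close> in \<open>srk\<close> meaningful.\<close>

lemma finite_family_of_span:
  assumes "F \<in> mpoly.span {m ^ d |m. m \<in> S}"
  shows "\<exists>r. \<exists>m :: nat \<Rightarrow> _. (\<forall>j<r. m j \<in> S) \<and> F \<in> mpoly.span ((\<lambda>j. m j ^ d) ` {..<r})"
proof -
  obtain t c where t: "finite t" "t \<subseteq> {m ^ d |m. m \<in> S}" "F = (\<Sum>a\<in>t. scale (c a) a)"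
    using assms unfolding mpoly.span_explicit by blast
  have F: "F \<in> mpoly.span t"
    unfolding t(3) by (intro mpoly.span_sum mpoly.span_scale mpoly.span_base)
  obtain h where "bij_betw h {0..<card t} t" using ex_bij_betw_nat_finite[OF t(1)] by blast
  then have h: "h ` {..<card t} = t" by (simp add: bij_betw_def lessThan_atLeast0)
  have "\<forall>j\<in>{..<card t}. \<exists>m. m \<in> S \<and> h j = m ^ d" using t(2) h by blast
  then obtain m where m: "\<forall>j\<in>{..<card t}. m j \<in> S \<and> h j = m j ^ d"
    by (rule bchoice[THEN exE])
  have "(\<lambda>j. m j ^ d) ` {..<card t} = h ` {..<card t}" using m by (intro image_cong) auto
  then have "(\<forall>j<card t. m j \<in> S) \<and> F \<in> mpoly.span ((\<lambda>j. m j ^ d) ` {..<card t})"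
    using m F h by simp
  then show ?thesis by blast
qed

lemma pderiv_var_power4_form_1:
  assumes "m \<in> forms n 1"
  shows "\<exists>c. pderiv_var i (m ^ 4) = scale c (m ^ 3)"
proof -
  obtain c where "pderiv_var i m = const c" using pderiv_var_form_1[OF assms] by blast
  then have "pderiv_var i (m ^ 4) = scale (4 * c) (m ^ 3)"
    by (simp add: power4_eq_xxxx power3_eq_cube pderiv_var_mult scale_def const_mult const_numeral algebra_simps)
  then show ?thesis by blast
qed

text \<open>By the chain rule the same linear forms that decompose \<open>F\<close> into fourth
  powers decompose its partials into cubes. This gives existence for \<open>psrk\<close>.\<close>

lemma partials_in_span:
  fixes r :: nat
  assumes "\<forall>j<r. m j \<in> forms n 1" "F \<in> mpoly.span ((\<lambda>j. m j ^ 4) ` {..<r})"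
  shows "pderiv_var i F \<in> mpoly.span ((\<lambda>j. m j ^ 3) ` {..<r})"
  using assms(2)
proof (induction rule: mpoly.span_induct_alt)
  case base
  then show ?case by (simp add: mpoly.span_zero)
next
  case (step a p q)
  then obtain j where j: "j < r" "p = m j ^ 4" by blast
  then obtain c where "pderiv_var i p = scale c (m j ^ 3)"
    using pderiv_var_power4_form_1 assms(1) by metis
  moreover have "m j ^ 3 \<in> mpoly.span ((\<lambda>j. m j ^ 3) ` {..<r})"
    using j by (intro mpoly.span_base) auto
  ultimately show ?case using step.IH
    by (auto simp only: pderiv_var_add pderiv_var_scale intro!: mpoly.span_add mpoly.span_scale)
qed

text \<open>As decompositions exist, both minima are attained; a minimal decomposition represents
  \<open>T\<close> in the shape that the two counting lemmas require.\<close>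

lemma quartic_frame_rank_bounds:
  fixes F :: "'a::field_char_0 mpoly"
  assumes frame: "quartic_frame T f0 f1 w y I g k0"
    and span: "F \<in> mpoly.span {m ^ 4 |m. m \<in> forms n 1}"
    and T: "\<And>p q r s. dir_deriv n s (dir_deriv n r (dir_deriv n q (dir_deriv n p F))) = const (T p q r s)"
  shows "4 * card I \<le> srk n 4 F \<and> 3 * card I \<le> psrk n 4 F"
proof -
  interpret quartic_frame T f0 f1 w y I g k0 by (rule frame)
  let ?P = "\<lambda>r. \<exists>m :: nat \<Rightarrow> 'a mpoly. (\<forall>j<r. m j \<in> forms n 1) \<and>
      F \<in> mpoly.span ((\<lambda>j. m j ^ 4) ` {..<r})"
  let ?Q = "\<lambda>r. \<exists>m :: nat \<Rightarrow> 'a mpoly. (\<forall>j<r. m j \<in> forms n 1) \<and>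
      (\<forall>i\<le>n. pderiv_var i F \<in> mpoly.span ((\<lambda>j. m j ^ (4 - 1)) ` {..<r}))"
  have ex: "\<exists>r. ?P r" using finite_family_of_span[OF span] .
  then obtain r and m :: "nat \<Rightarrow> 'a mpoly" where "\<forall>j<r. m j \<in> forms n 1" "F \<in> mpoly.span ((\<lambda>j. m j ^ 4) ` {..<r})"
    by blast
  then have "?Q r" using partials_in_span[of r m n F] by (intro exI[of _ m]) simp
  then have "\<exists>r. ?Q r" by (rule exI)
  then have "?Q (psrk n 4 F)" unfolding psrk_def by (rule LeastI_ex)
  then obtain m where m: "\<forall>j<psrk n 4 F. m j \<in> forms n 1"
      "\<forall>i\<le>n. pderiv_var i F \<in> mpoly.span ((\<lambda>j. m j ^ 3) ` {..<psrk n 4 F})" by auto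
  obtain A M where "\<forall>p q r s. T p q r s = (\<Sum>j<psrk n 4 F. A j p * M j q * M j r * M j s)"
    using four_linear_form_of_partials[OF m T] by blast
  then have psrk: "3 * card I \<le> psrk n 4 F"
    using card_partials_ge[of "{..<psrk n 4 F}" A M] by simp
  have "?P (srk n 4 F)" using ex unfolding srk_def by (rule LeastI_ex)
  then obtain m where m: "\<forall>j<srk n 4 F. m j \<in> forms n 1"
      "F \<in> mpoly.span ((\<lambda>j. m j ^ 4) ` {..<srk n 4 F})" by blast
  obtain c M where "\<forall>p q r s. T p q r s = (\<Sum>j<srk n 4 F. c j * M j p * M j q * M j r * M j s)"
    using four_linear_form_of_powers[OF m T] by blast
  then have "4 * card I \<le> srk n 4 F"
    using card_powers_ge[of "{..<srk n 4 F}" c M] by simp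
  then show ?thesis using psrk by simp
qed

text \<open>The signs of b, c, d run through all eight choices. Only the monomial abcd is odd in
  each of b, c, d, and its multinomial coefficient is 24, whence 8 * 24 = 192. The difference in d
  is taken first, which leaves an identity for cubes.\<close>

lemma polarization_4:
  fixes a b c d :: "'a::comm_ring_1"
  shows "(a + b + c + d) ^ 4 - (a + b + c - d) ^ 4 - ((a + b - c + d) ^ 4 - (a + b - c - d) ^ 4)
      - ((a - b + c + d) ^ 4 - (a - b + c - d) ^ 4) + ((a - b - c + d) ^ 4 - (a - b - c - d) ^ 4)
      = 192 * (a * b * c * d)"
proof -
  have fourth: "(x + y) ^ 4 - (x - y) ^ 4 = 8 * (x ^ 3 * y + x * y ^ 3)" for x y :: 'a
    by (simp add: power4_eq_xxxx power3_eq_cube algebra_simps)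
  have cube: "(a + b + c) ^ 3 - (a + b - c) ^ 3 - (a - b + c) ^ 3 + (a - b - c) ^ 3 = 24 * (a * b * c)"
    by (simp add: power3_eq_cube algebra_simps)
  have "8 * ((a + b + c) ^ 3 * d + (a + b + c) * d ^ 3) - 8 * ((a + b - c) ^ 3 * d + (a + b - c) * d ^ 3)
      - 8 * ((a - b + c) ^ 3 * d + (a - b + c) * d ^ 3) + 8 * ((a - b - c) ^ 3 * d + (a - b - c) * d ^ 3)
      = 8 * ((a + b + c) ^ 3 - (a + b - c) ^ 3 - (a - b + c) ^ 3 + (a - b - c) ^ 3) * d"
    by (simp add: ring_distribs mult.assoc)
  then show ?thesis unfolding fourth cube by (simp add: mult.assoc)
qed

lemma forms_add: "p \<in> forms n d \<Longrightarrow> q \<in> forms n d \<Longrightarrow> p + q \<in> forms n d"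
  unfolding forms_def using Poly_Mapping.keys_add[of p q] by blast

lemma forms_const_mult:
  assumes "p \<in> forms n d"
  shows "const c * p \<in> forms n d"
proof -
  have "Poly_Mapping.keys (const c * p) \<subseteq> Poly_Mapping.keys p"
    using keys_mult[of "const c" p] by (auto simp: const_def split: if_splits)
  then show ?thesis using assms unfolding forms_def by blast
qed

lemma forms_minus: "p \<in> forms n d \<Longrightarrow> - p \<in> forms n d"
  using forms_const_mult[of p n d "-1"] by (simp add: const_minus)

lemma forms_diff: "p \<in> forms n d \<Longrightarrow> q \<in> forms n d \<Longrightarrow> p - q \<in> forms n d"
  using forms_add[of p n d "- q"] forms_minus[of q n d] by simp

lemma var_forms: "i \<le> n \<Longrightarrow> var i \<in> forms n 1"
  by (simp add: forms_def var_def)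

lemma product_in_span_powers4:
  fixes a b c d :: "'a::field_char_0 mpoly"
  assumes "a \<in> forms n 1" "b \<in> forms n 1" "c \<in> forms n 1" "d \<in> forms n 1"
  shows "a * b * c * d \<in> mpoly.span {m ^ 4 |m. m \<in> forms n 1}"
proof -
  have power: "m \<in> forms n 1 \<Longrightarrow> m ^ 4 \<in> mpoly.span {m ^ 4 |m. m \<in> forms n 1}" for m :: "'a mpoly"
    by (rule mpoly.span_base) blast
  have "192 * (a * b * c * d) \<in> mpoly.span {m ^ 4 |m. m \<in> forms n 1}"
    unfolding polarization_4[symmetric] using assms
    by (intro mpoly.span_add mpoly.span_diff power forms_add forms_diff)
  then have "scale (1 / 192) (192 * (a * b * c * d)) \<in> mpoly.span {m ^ 4 |m. m \<in> forms n 1}"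
    by (rule mpoly.span_scale)
  moreover have "scale (1 / 192) (192 * x) = x" for x :: "'a mpoly"
  proof -
    have "scale (1 / 192) (192 * x) = const (1 / 192 * 192) * x"
      by (simp only: scale_def const_mult const_numeral mult.assoc)
    then show ?thesis by simp
  qed
  ultimately show ?thesis by simp
qed

lemma quadric_multiple_in_span_powers4:
  fixes p0 p1 Q :: "'a::field_char_0 mpoly"
  assumes p: "p0 \<in> forms n 1" "p1 \<in> forms n 1"
    and Q: "Q \<in> mpoly.span {u * v |u v. u \<in> forms n 1 \<and> v \<in> forms n 1}"
  shows "p0 * p1 * Q \<in> mpoly.span {m ^ 4 |m. m \<in> forms n 1}"
  using Q
proof (induction rule: mpoly.span_induct_alt)
  case base
  then show ?case by (simp add: mpoly.span_zero)
next
  case (step a q Q)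
  then obtain u v where uv: "q = u * v" "u \<in> forms n 1" "v \<in> forms n 1" by blast
  have "p0 * p1 * (scale a q + Q) = scale a (p0 * p1 * u * v) + p0 * p1 * Q"
    by (simp add: uv scale_def algebra_simps)
  then show ?case using step product_in_span_powers4[OF p uv(2,3)]
    by (auto intro!: mpoly.span_add mpoly.span_scale)
qed

lemma dir_deriv_const_mult: "dir_deriv n v (const c * p) = const c * dir_deriv n v p"
  by (simp add: dir_deriv_mult)

text \<open>By the Leibniz rule this is the fourth derivative of a product of two quadrics with
  second derivatives \<open>A\<close> and \<open>B\<close>: only terms that derive each factor twice
  survive, one for each choice of two of the four directions.\<close>

definition product_polar :: "('v \<Rightarrow> 'v \<Rightarrow> 'a) \<Rightarrow> ('v \<Rightarrow> 'v \<Rightarrow> 'a) \<Rightarrow> 'v \<Rightarrow> 'v \<Rightarrow> 'v \<Rightarrow> 'v \<Rightarrow> 'a::comm_ring_1" where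
  "product_polar A B p q r s =
     A p q * B r s + A p r * B q s + A p s * B q r + A q r * B p s + A q s * B p r + A r s * B p q"

lemma dir_deriv_product_quadrics:
  assumes A: "\<And>u v. dir_deriv n v (dir_deriv n u P) = const (A u v)"
    and B: "\<And>u v. dir_deriv n v (dir_deriv n u Q) = const (B u v)"
  shows "dir_deriv n s (dir_deriv n r (dir_deriv n q (dir_deriv n p (P * Q)))) =
    const (product_polar A B p q r s)"
proof -
  have 2: "dir_deriv n q (dir_deriv n p (P * Q)) = const (A p q) * Q + dir_deriv n p P * dir_deriv n q Q
      + (dir_deriv n q P * dir_deriv n p Q + P * const (B p q))"
    by (simp only: dir_deriv_mult dir_deriv_add A B)
  have 3: "dir_deriv n r (dir_deriv n q (dir_deriv n p (P * Q))) =
      const (A p q) * dir_deriv n r Q + const (A p r) * dir_deriv n q Q + dir_deriv n p P * const (B q r)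
      + const (A q r) * dir_deriv n p Q + dir_deriv n q P * const (B p r) + dir_deriv n r P * const (B p q)"
    unfolding 2 by (simp add: dir_deriv_mult dir_deriv_add A B add_ac)
  show ?thesis
    unfolding 3 product_polar_def by (simp add: dir_deriv_mult dir_deriv_add A B const_add const_mult add_ac)
qed

section \<open>Products of two linear forms and a quadric\<close>

text \<open>Since \<open>a\<close> and \<open>b\<close> vanish on every w_i, the linear factors must
  absorb two arguments among f0, f1, and only the pair f0, f1 counts. So T(f0, f1, w_i, w_k) =
  B(w_i, w_k), and every term with three arguments w is zero.\<close>

lemma product_polar_frame:
  fixes a b :: "'v \<Rightarrow> 'a::field_char_0"
  assumes "finite I"
    and "a f0 = 1" "a f1 = 0" "\<And>i. i \<in> I \<Longrightarrow> a (w i) = 0"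
    and "b f0 = 0" "b f1 = 1" "\<And>i. i \<in> I \<Longrightarrow> b (w i) = 0"
    and "\<And>u v. B u v = B v u"
    and "\<And>i k. i \<in> I \<Longrightarrow> k \<in> I \<Longrightarrow> B (w i) (w k) = (if i = k then 2 else 0)"
  shows "quartic_frame (product_polar (\<lambda>u v. a u * b v + a v * b u) B) f0 f1 w w I (\<lambda>_. 2) k0"
  using assms by unfold_locales (auto simp: product_polar_def)

text \<open>
  Here the quadric restricted to the span of the w_i has the radical w_k0, which is dual to f1; so f1
  replaces w_k0 on the other side of the pairing.
\<close>

lemma product_polar_frame_degenerate:
  fixes a b :: "'v \<Rightarrow> 'a::field_char_0"
  assumes "finite I"
    and "a f0 = 1" "a f1 = 0" "\<And>i. i \<in> I \<Longrightarrow> a (w i) = 0"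
    and "b f0 = 0" "b f1 = 1" "\<And>i. i \<in> I \<Longrightarrow> b (w i) = 0"
    and "\<And>u v. B u v = B v u"
    and "\<And>i k. i \<in> I \<Longrightarrow> k \<in> I \<Longrightarrow> B (w i) (w k) = (if i = k \<and> i \<noteq> k0 then 2 else 0)"
    and "\<And>i. i \<in> I \<Longrightarrow> B f1 (w i) = (if i = k0 then 1 else 0)"
  shows "quartic_frame (product_polar (\<lambda>u v. a u * b v + a v * b u) B) f0 f1 w (w(k0 := f1)) I (\<lambda>_. 2) k0"
proof -
  have "\<And>i. i \<in> I \<Longrightarrow> B (w i) f1 = (if i = k0 then 1 else 0)" using assms by metis
  \<comment> \<open>In T(f0, f1, w_i, f1) the vector f1 occurs twice, so \<open>B f1 (w i)\<close>
    is counted twice; the diagonal entry at \<open>k0\<close> is therefore 2 as well.\<close>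
  with assms show ?thesis by unfold_locales (auto simp: product_polar_def)
qed

section \<open>Rank bounds for two families of quartics in coordinates\<close>

definition unit_vec :: "nat \<Rightarrow> nat \<Rightarrow> 'a::zero_neq_one" where
  "unit_vec i j = (if j = i then 1 else 0)"

lemma product_rank_bounds:
  fixes p0 p1 Q :: "'a::field_char_0 mpoly"
  assumes p: "p0 \<in> forms n 1" "p1 \<in> forms n 1"
    and Q: "Q \<in> mpoly.span {u * v |u v. u \<in> forms n 1 \<and> v \<in> forms n 1}"
    and a: "\<And>v. dir_deriv n v p0 = const (a v)" and b: "\<And>v. dir_deriv n v p1 = const (b v)"
    and B: "\<And>u v. dir_deriv n v (dir_deriv n u Q) = const (B u v)"
    and frame: "quartic_frame (product_polar (\<lambda>u v. a u * b v + a v * b u) B) f0 f1 w y {2..n} g k0"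
  shows "4 * (n - 1) \<le> srk n 4 (p0 * p1 * Q) \<and> 3 * (n - 1) \<le> psrk n 4 (p0 * p1 * Q)"
proof -
  have "dir_deriv n v (dir_deriv n u (p0 * p1)) = const (a u * b v + a v * b u)" for u v
    by (simp add: dir_deriv_mult dir_deriv_add a b const_add const_mult mult.commute add.commute)
  then show ?thesis
    using quartic_frame_rank_bounds[OF frame quadric_multiple_in_span_powers4[OF p Q]
        dir_deriv_product_quadrics[OF _ B]] by simp
qed

lemma form_product_in_span:
  "u \<in> forms n 1 \<Longrightarrow> v \<in> forms n 1 \<Longrightarrow>
    u * v \<in> mpoly.span {u * v |u v. u \<in> forms n 1 \<and> v \<in> forms n (1::nat)}"
  by (rule mpoly.span_base) blast

lemma sum_squares_in_span:
  assumes "A \<subseteq> {..n}"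
  shows "(\<Sum>i\<in>A. var i ^ 2) \<in> mpoly.span {u * v |u v. u \<in> forms n 1 \<and> v \<in> forms n 1}"
  using assms unfolding power2_eq_square
  by (intro mpoly.span_sum form_product_in_span var_forms) auto

lemma dir_deriv_sum_squares:
  assumes "A \<subseteq> {..n}"
  shows "dir_deriv n v (dir_deriv n u (\<Sum>i\<in>A. var i ^ 2)) = const (\<Sum>i\<in>A. 2 * u i * v i)"
  unfolding dir_deriv_sum const_sum
proof (rule sum.cong)
  fix i assume "i \<in> A"
  then have "i \<le> n" using assms by auto
  then have "dir_deriv n v (dir_deriv n u (var i ^ 2)) = const (u i) * const (v i) + const (v i) * const (u i)"
    by (simp add: power2_eq_square dir_deriv_mult dir_deriv_add dir_deriv_var)
  then show "dir_deriv n v (dir_deriv n u (var i ^ 2)) = const (2 * u i * v i)"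
    by (simp add: const_mult const_numeral algebra_simps)
qed simp

lemma sum_unit_vec:
  assumes "finite A"
  shows "(\<Sum>m\<in>A. 2 * unit_vec i m * unit_vec k m) = (if i = k \<and> i \<in> A then 2 else (0 :: 'a::field_char_0))"
proof -
  have "(\<Sum>m\<in>A. 2 * unit_vec i m * unit_vec k m) = (\<Sum>m\<in>A. if m = i then (if i = k then 2 else 0) else (0 :: 'a))"
    by (intro sum.cong) (auto simp: unit_vec_def)
  then show ?thesis using assms by simp
qed

text \<open>One family for the quartics whose quadric is nondegenerate on the common kernel of the
  two linear factors.\<close>

lemma rank_bounds_nondegenerate:
  fixes \<alpha> \<beta> c d e :: "'a::field_char_0"
  assumes n: "n \<ge> 3" and c\<beta>: "c = 0 \<or> \<beta> = 0"
  defines "F \<equiv> var 0 * (const \<alpha> * var 0 + var 1 + const \<beta> * var 2)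
      * (const d * (var 0 * var 0) + const c * (var 1 * var 1) + const e * (var 0 * var 1) + (\<Sum>i=2..n. var i ^ 2))"
  shows "4 * (n - 1) \<le> srk n 4 F \<and> 3 * (n - 1) \<le> psrk n 4 F"
  unfolding F_def
proof (rule product_rank_bounds)
  let ?Q = "const d * (var 0 * var 0) + const c * (var 1 * var 1) + const e * (var 0 * var 1) + (\<Sum>i=2..n. var i ^ 2)"
  show "var 0 \<in> forms n 1" "const \<alpha> * var 0 + var 1 + const \<beta> * var 2 \<in> forms n 1"
    using n by (intro forms_add forms_const_mult var_forms; simp)+
  show "?Q \<in> mpoly.span {u * v |u v. u \<in> forms n 1 \<and> v \<in> forms n 1}"
    unfolding scale_def[symmetric] using n
    by (intro mpoly.span_add mpoly.span_scale form_product_in_span sum_squares_in_span var_forms) auto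
  show "dir_deriv n v (var 0) = const (v 0)" for v :: "nat \<Rightarrow> 'a"
    by (simp add: dir_deriv_var)
  show "dir_deriv n v (const \<alpha> * var 0 + var 1 + const \<beta> * var 2) = const (\<alpha> * v 0 + v 1 + \<beta> * v 2)" for v
    using n by (simp add: dir_deriv_add dir_deriv_const_mult dir_deriv_var const_add const_mult)
  define B where "B u v = 2 * d * u 0 * v 0 + 2 * c * u 1 * v 1 + e * (u 0 * v 1 + u 1 * v 0)
      + (\<Sum>i=2..n. 2 * u i * v i)" for u v :: "nat \<Rightarrow> 'a"
  show "dir_deriv n v (dir_deriv n u ?Q) = const (B u v)" for u v
    using n by (simp add: B_def dir_deriv_add dir_deriv_const_mult dir_deriv_sum_squares dir_deriv_mult
        dir_deriv_var const_add const_mult const_numeral algebra_simps)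
  \<comment> \<open>Subtracting \<beta> e_1 from e_2 puts w_2 into the kernel of the second factor.
    This adds 2 c \<beta>^2 to B(w_2, w_2), which is zero by \<open>c\<beta>\<close>; the sum over
    2..n does not see index 1.\<close>
  define w where "w i = (\<lambda>j. unit_vec i j - (if i = 2 then \<beta> * unit_vec 1 j else 0))" for i
  have w_sum: "(\<Sum>m=2..n. 2 * w i m * w k m) = (\<Sum>m=2..n. 2 * unit_vec i m * unit_vec k m)" for i k
    by (intro sum.cong) (auto simp: w_def unit_vec_def)
  \<comment> \<open>The vectors e_0 - \<alpha> e_1 and e_1 are dual to the two linear
    factors.\<close>
  show "quartic_frame (product_polar (\<lambda>u v. u 0 * (\<alpha> * v 0 + v 1 + \<beta> * v 2) + v 0 * (\<alpha> * u 0 + u 1 + \<beta> * u 2)) B)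
      (\<lambda>j. unit_vec 0 j - \<alpha> * unit_vec 1 j) (unit_vec 1) w w {2..n} (\<lambda>_. 2) 2"
  proof (rule product_polar_frame)
    fix i k assume "i \<in> {2..n}" "k \<in> {2..n}"
    then show "B (w i) (w k) = (if i = k then 2 else 0)"
      unfolding B_def w_sum sum_unit_vec[OF finite_atLeastAtMost]
      using c\<beta> by (auto simp: w_def unit_vec_def)
  qed (auto simp: w_def unit_vec_def B_def mult_ac add_ac)
qed

text \<open>On the common kernel of x_0 and x_1, spanned by e_2, ..., e_n, the quadric has the
  radical e_2, and the term x_1 x_2 pairs e_2 with f1 = e_1. Hence \<open>k0\<close> is 2.\<close>

lemma rank_bounds_degenerate:
  fixes d :: "'a::field_char_0"
  assumes n: "n \<ge> 3"
  defines "F \<equiv> var 0 * var 1 * (const d * (var 0 * var 0) + var 1 * var 2 + (\<Sum>i=3..n. var i ^ 2))"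
  shows "4 * (n - 1) \<le> srk n 4 F \<and> 3 * (n - 1) \<le> psrk n 4 F"
  unfolding F_def
proof (rule product_rank_bounds)
  let ?Q = "const d * (var 0 * var 0) + var 1 * var 2 + (\<Sum>i=3..n. var i ^ 2)"
  show "var 0 \<in> forms n 1" "var 1 \<in> forms n 1" using n by (intro var_forms; simp)+
  show "?Q \<in> mpoly.span {u * v |u v. u \<in> forms n 1 \<and> v \<in> forms n 1}"
    unfolding scale_def[symmetric] using n
    by (intro mpoly.span_add mpoly.span_scale form_product_in_span sum_squares_in_span var_forms) auto
  show "dir_deriv n v (var 0) = const (v 0)" "dir_deriv n v (var 1) = const (v 1)" for v :: "nat \<Rightarrow> 'a"
    using n by (simp_all add: dir_deriv_var)
  define B where "B u v = 2 * d * u 0 * v 0 + (u 1 * v 2 + u 2 * v 1) + (\<Sum>i=3..n. 2 * u i * v i)"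
    for u v :: "nat \<Rightarrow> 'a"
  show "dir_deriv n v (dir_deriv n u ?Q) = const (B u v)" for u v
    using n by (simp add: B_def dir_deriv_add dir_deriv_const_mult dir_deriv_sum_squares dir_deriv_mult
        dir_deriv_var const_add const_mult const_numeral algebra_simps)
  show "quartic_frame (product_polar (\<lambda>u v. u 0 * v 1 + v 0 * u 1) B)
      (unit_vec 0) (unit_vec 1) unit_vec (unit_vec(2 := unit_vec 1)) {2..n} (\<lambda>_. 2) 2"
  proof (rule product_polar_frame_degenerate)
    fix i k assume i: "i \<in> {2..n}" and k: "k \<in> {2..n}"
    show "B (unit_vec i) (unit_vec k) = (if i = k \<and> i \<noteq> 2 then 2 else 0)"
      unfolding B_def sum_unit_vec[OF finite_atLeastAtMost] using i k by (auto simp: unit_vec_def)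
    show "B (unit_vec 1) (unit_vec i) = (if i = 2 then 1 else 0)"
      unfolding B_def sum_unit_vec[OF finite_atLeastAtMost] using i by (auto simp: unit_vec_def)
  qed (auto simp: unit_vec_def B_def mult_ac add_ac)
qed

theorem proposition4p3:
  fixes n :: nat and l :: "'a :: {alg_closed_field, field_char_0}" and F :: "'a mpoly"
  assumes "n \<ge> 3"
  assumes "F \<in> {
      var 0 * var 1 * (\<Sum>i=2..n. var i ^ 2),
      var 0 * var 1 * (var 1 * var 2 + (\<Sum>i=3..n. var i ^ 2)),
      var 0 * var 1 * (\<Sum>i=1..n. var i ^ 2),
      var 0 * (var 0 + var 1) * (\<Sum>i=1..n. var i ^ 2),
      var 0 * (const l * var 0 + var 1) * (\<Sum>i=0..n. var i ^ 2),
      var 0 * var 1 * (var 0 ^ 2 + var 1 * var 2 + (\<Sum>i=3..n. var i ^ 2)),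
      var 0 * (- const (l ^ 2) * var 0 + var 1 + const l * var 2)
        * (var 0 * var 1 + (\<Sum>i=2..n. var i ^ 2))}"
  shows "srk n 4 F \<ge> 4 * (n - 1) \<and> psrk n 4 F \<ge> 3 * (n - 1)"
proof -
  have split1: "(\<Sum>i=1..n. var i ^ 2) = var 1 * var 1 + (\<Sum>i=2..n. var i ^ 2 :: 'a mpoly)"
    using assms(1) sum.atLeast_Suc_atMost[of 1 n "\<lambda>i. var i ^ 2 :: 'a mpoly"]
    by (simp add: power2_eq_square numeral_2_eq_2)
  have split0: "(\<Sum>i=0..n. var i ^ 2) = var 0 * var 0 + (var 1 * var 1 + (\<Sum>i=2..n. var i ^ 2 :: 'a mpoly))"
    unfolding split1[symmetric] by (simp add: sum.atLeast_Suc_atMost[of 0] power2_eq_square)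
  \<comment> \<open>The parameters of \<open>nd\<close> are instantiated in the order c, \<beta>,
    \<alpha>, d, e.\<close>
  note nd = rank_bounds_nondegenerate[OF assms(1), where 'a = 'a]
  note dg = rank_bounds_degenerate[OF assms(1), where 'a = 'a]
  from assms(2) consider
      "F = var 0 * var 1 * (\<Sum>i=2..n. var i ^ 2)"
    | "F = var 0 * var 1 * (var 1 * var 2 + (\<Sum>i=3..n. var i ^ 2))"
    | "F = var 0 * var 1 * (\<Sum>i=1..n. var i ^ 2)"
    | "F = var 0 * (var 0 + var 1) * (\<Sum>i=1..n. var i ^ 2)"
    | "F = var 0 * (const l * var 0 + var 1) * (\<Sum>i=0..n. var i ^ 2)"
    | "F = var 0 * var 1 * (var 0 ^ 2 + var 1 * var 2 + (\<Sum>i=3..n. var i ^ 2))"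
    | "F = var 0 * (- const (l ^ 2) * var 0 + var 1 + const l * var 2)
        * (var 0 * var 1 + (\<Sum>i=2..n. var i ^ 2))" by blast
  then show ?thesis
  proof cases
    case 1 then show ?thesis using nd[of 0 0 0 0 0] by simp
  next
    case 2 then show ?thesis using dg[of 0] by simp
  next
    case 3 then show ?thesis using nd[of 1 0 0 0 0] unfolding split1 by simp
  next
    case 4 then show ?thesis using nd[of 1 0 1 0 0] unfolding split1 by simp
  next
    case 5 then show ?thesis using nd[of 1 0 l 1 0] unfolding split0 by (simp add: add.assoc)
  next
    case 6 then show ?thesis using dg[of 1] by (simp add: power2_eq_square)
  next
    case 7 then show ?thesis using nd[of 0 l "- l\<^sup>2" 0 1] by (simp add: const_minus)
  qed
qed

end
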